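(* Let the initial-value problem $y'(t)=\Phi(t,y(t))$, $y(0)=v$, $t\in[0,T]$, with solution $y(t)$, be given, where for every $k=0,1,2,\dots$ one has the splitting $\Phi(t,y)=-A_k y+f_k(y)+g(t)$ for all $y\in\mathbb{R}^N$, $t\ge 0$. Assume that the mappings $f_k$ are all Lipschitz continuous with a common Lipschitz constant $L$, and that there exist constants $C>0$ and $\omega\ge 0$ such that the matrices $A_k$ satisfy a common exponential bound, i.e. for all $k$ $$\|f_k(u)-f_k(w)\|\le L\|u-w\|\quad \forall u,w\in\mathbb{R}^N,\qquad \|\exp(-tA_k)\|\le Ce^{-\omega t}\quad\forall t\ge 0.$$ Let the problem be solved iteratively by nonlinear waveform relaxation: $y_0(t)$, $t\in[0,T]$, is an initial approximation to $y(t)$ with $y_0(0)=v$, and for $k=0,1,2,\dots$ the function $y_{k+1}$ is the solution of the linear initial-value problem $$y_{k+1}'(t)=-A_k y_{k+1}(t)+f_k(y_k(t))+g(t),\quad y_{k+1}(0)=v,\quad t\in[0,T].$$ Then the errors $\epsilon_k(t)=y(t)-y_k(t)$ satisfy, for $k=0,1,\dots$, $$\|\epsilon_{k+1}(t)\|\le C L\, t\,\varphi_1(-\omega t)\max_{s\in[0,t]}\|\epsilon_k(s)\|,\qquad \forall t\in[0,T],$$ and the nonlinear waveform relaxation iteration converges for $t\in[0,T]$ to the solution $y(t)$ provided that $$C L T\varphi_1(-\omega T)<1.$$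
   Context: $\Phi:\mathbb{R}\times\mathbb{R}^N\to\mathbb{R}^N$, $v\in\mathbb{R}^N$ and $T>0$ are given; $A_k\in\mathbb{R}^{N\times N}$; $f_k:\mathbb{R}^N\to\mathbb{R}^N$; $g:\mathbb{R}\to\mathbb{R}^N$. $\|\cdot\|$ is a vector norm in $\mathbb{C}^N$ or the corresponding induced matrix norm. The entire functions $\varphi_j$ are defined by $\varphi_0(z)=e^z$, $\varphi_{j+1}(z)=\frac{\varphi_j(z)-\varphi_j(0)}{z}$, with $\varphi_j(0)=1/j!$; in particular $\varphi_1(z)=(e^z-1)/z$ for $z\ne 0$ and $\varphi_1(0)=1$. *)

theory Defs
  imports "HOL-Analysis.Analysis"
begin

definition is_vector_norm :: "(complex ^ 'n \<Rightarrow> real) \<Rightarrow> bool" where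
  "is_vector_norm nrm \<longleftrightarrow>
     (\<forall>x. 0 \<le> nrm x) \<and>
     (\<forall>x. nrm x = 0 \<longleftrightarrow> x = 0) \<and>
     (\<forall>c x. nrm (c *s x) = cmod c * nrm x) \<and>
     (\<forall>x y. nrm (x + y) \<le> nrm x + nrm y)"

(* The supremum runs over complex vectors also when the matrix is the image of a real one:
   for a general norm, restricting it to real vectors may give a smaller value. *)
definition induced_matrix_norm :: "(complex ^ 'n \<Rightarrow> real) \<Rightarrow> complex ^ 'n ^ 'n \<Rightarrow> real" where
  "induced_matrix_norm nrm A = (SUP x\<in>{x. x \<noteq> 0}. nrm (A *v x) / nrm x)"

definition vec_of_real :: "real ^ 'n \<Rightarrow> complex ^ 'n" where
  "vec_of_real x = (\<chi> i. complex_of_real (x $ i))"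

definition mat_of_real :: "real ^ 'n ^ 'n \<Rightarrow> complex ^ 'n ^ 'n" where
  "mat_of_real A = map_matrix complex_of_real A"

(* The library's exp does not apply here: multiplication on the type of matrices is
   componentwise, and the matrix product is **. *)
definition matrix_exp :: "real ^ 'n ^ 'n \<Rightarrow> real ^ 'n ^ 'n" where
  "matrix_exp A = (\<Sum>k. (1 / fact k) *\<^sub>R (((**) A ^^ k) (mat 1)))"

(* Polymorphic so that the entire functions (type complex) and their restrictions to the
   real line (type real) are both instances. *)
primrec phi :: "nat \<Rightarrow> 'a::{real_normed_field, banach} \<Rightarrow> 'a" where
  "phi 0 = exp"
| "phi (Suc j) = (\<lambda>z. if z = 0 then 1 / fact (Suc j) else (phi j z - phi j 0) / z)"

end

theory Submission
  imports Defs
begin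

text \<open>
  The error satisfies \<open>\<epsilon>' = - A\<^sub>k \<epsilon> + r\<close> with \<open>r = f\<^sub>k(y) - f\<^sub>k(y\<^sub>k)\<close>, so
  \<open>F(s) = exp(- (t - s) A\<^sub>k) \<epsilon>(s)\<close> runs from \<open>0\<close> to \<open>\<epsilon>(t)\<close> on \<open>[0, t]\<close> and has the derivative
  \<open>exp(- (t - s) A\<^sub>k) r(s)\<close>. Its norm is at most \<open>C e\<^bsup>-\<omega>(t-s)\<^esup> L max \<parallel>\<epsilon>\<^sub>k\<parallel>\<close>, whose integral over
  \<open>[0, t]\<close> is the stated bound. Since \<open>t \<phi>\<^sub>1(- \<omega> t)\<close> increases with \<open>t\<close>, the iteration contracts
  in the maximum norm on \<open>[0, T]\<close>.
\<close>

section \<open>Norms on Euclidean spaces\<close>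

text \<open>Isolates what the estimates use of a norm, so that one set of facts serves both
  \<open>nrm\<close> on complex vectors and its composition with \<open>vec_of_real\<close> on real
  vectors. The fields are real homogeneity, the triangle inequality and definiteness; nonnegativity
  follows from them.\<close>

locale real_norm =
  fixes p :: "'a::euclidean_space \<Rightarrow> real"
  assumes triangle: "p (x + y) \<le> p x + p y"
    and scale: "p (r *\<^sub>R x) = \<bar>r\<bar> * p x"
    and definite: "p x = 0 \<Longrightarrow> x = 0"
begin

lemma zero [simp]: "p 0 = 0"
  using scale[of 0 0] by simp

lemma minus [simp]: "p (- x) = p x"
  using scale[of "-1" x] by simp

lemma nonneg: "0 \<le> p x"
  using triangle[of x "- x"] by simp

lemma sum_le: "p (sum h S) \<le> (\<Sum>i\<in>S. p (h i))"
proof (induction S rule: infinite_finite_induct)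
  case (insert x S)
  then show ?case using triangle[of "h x" "sum h S"] by simp
qed auto

lemma le_norm: obtains K where "K > 0" "\<And>x. p x \<le> K * norm x"
proof
  let ?K = "\<Sum>b\<in>Basis. p b"
  \<comment> \<open>Adding 1 to the sum of the norms of the basis vectors gives a constant that is
    visibly positive.\<close>
  show "1 + ?K > 0"
    by (simp add: add_pos_nonneg sum_nonneg nonneg)
  show "p x \<le> (1 + ?K) * norm x" for x
  proof -
    have "p x = p (\<Sum>b\<in>Basis. (x \<bullet> b) *\<^sub>R b)"
      by (simp add: euclidean_representation)
    also have "\<dots> \<le> (\<Sum>b\<in>Basis. \<bar>x \<bullet> b\<bar> * p b)"
      using sum_le[of "\<lambda>b. (x \<bullet> b) *\<^sub>R b" Basis] by (simp add: scale)
    also have "\<dots> \<le> (\<Sum>b\<in>Basis. norm x * p b)"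
      by (intro sum_mono mult_right_mono nonneg Basis_le_norm)
    also have "\<dots> = ?K * norm x"
      by (simp add: sum_distrib_left mult.commute)
    also have "\<dots> \<le> (1 + ?K) * norm x"
      by (simp add: distrib_right)
    finally show ?thesis .
  qed
qed

lemma abs_diff_le: "\<bar>p x - p y\<bar> \<le> p (x - y)"
proof -
  have "p x \<le> p (x - y) + p y" using triangle[of "x - y" y] by simp
  moreover have "p y \<le> p (x - y) + p x"
    using triangle[of "y - x" x] minus[of "x - y"] by simp
  ultimately show ?thesis by linarith
qed

lemma continuous_on: "continuous_on S p"
proof -
  obtain K where K: "K > 0" "\<And>x. p x \<le> K * norm x" by (rule le_norm) blast
  have "K-lipschitz_on S p"
  proof (rule lipschitz_onI)
    show "dist (p x) (p y) \<le> K * dist x y" for x y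
      using abs_diff_le[of x y] K(2)[of "x - y"] by (simp add: dist_norm)
  qed (use K in simp)
  then show ?thesis by (rule lipschitz_on_continuous_on)
qed

text \<open>Compactness: \<open>p\<close> is continuous, so it attains its minimum on the Euclidean
  unit sphere, and that minimum is positive by definiteness. Homogeneity carries the bound to all
  vectors. Together with \<open>le_norm\<close>, \<open>p\<close> is equivalent to the Euclidean
  norm.\<close>

lemma norm_le: obtains K where "K > 0" "\<And>x. norm x \<le> K * p x"
proof -
  obtain b :: 'a where b: "b \<in> Basis" using nonempty_Basis by blast
  then have "b \<in> sphere 0 1" by simp
  then obtain z where z: "z \<in> sphere 0 1" "\<And>x. x \<in> sphere 0 1 \<Longrightarrow> p z \<le> p x"
    using continuous_attains_inf[OF compact_sphere _ continuous_on, of 0 1] by blast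
  then have pz: "p z > 0"
    using definite[of z] nonneg[of z] by fastforce
  show ?thesis
  proof
    show "1 / p z > 0" using pz by simp
    show "norm x \<le> 1 / p z * p x" for x
    proof (cases "x = 0")
      case False
      have "p z \<le> p ((1 / norm x) *\<^sub>R x)"
        using False by (intro z(2)) simp
      then have "p z \<le> p x / norm x" by (simp add: scale)
      then show ?thesis using False pz by (simp add: field_simps)
    qed simp
  qed
qed

text \<open>On a common tagged division the triangle inequality compares the two Riemann sums
  directly. The inequality survives in the limit because \<open>p\<close> is dominated by the
  Euclidean norm, in which the sums converge.\<close>

lemma has_integral_le:
  fixes h :: "'b::euclidean_space \<Rightarrow> 'a"
  assumes h: "(h has_integral I) (cbox a b)" and k: "(k has_integral J) (cbox a b)"
    and le: "\<And>x. x \<in> cbox a b \<Longrightarrow> p (h x) \<le> k x"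
  shows "p I \<le> J"
proof (rule field_le_epsilon)
  fix e :: real assume e: "e > 0"
  obtain K where K: "K > 0" "\<And>x. p x \<le> K * norm x" by (rule le_norm) blast
  \<comment> \<open>Chosen so that the error \<open>K * d\<close> of the first sum, measured by
    \<open>p\<close>, and the error \<open>d\<close> of the second add up to
    \<open>e\<close>.\<close>
  define d where "d = e / (K + 1)"
  have d: "d > 0" using e K by (simp add: d_def)
  obtain \<gamma>1 where g1: "gauge \<gamma>1" "\<And>\<D>. \<D> tagged_division_of (cbox a b) \<Longrightarrow> \<gamma>1 fine \<D> \<Longrightarrow>
      norm ((\<Sum>(x,k)\<in>\<D>. measure lborel k *\<^sub>R h x) - I) < d"
    by (rule has_integralD[OF h d]) blast
  obtain \<gamma>2 where g2: "gauge \<gamma>2" "\<And>\<D>. \<D> tagged_division_of (cbox a b) \<Longrightarrow> \<gamma>2 fine \<D> \<Longrightarrow>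
      norm ((\<Sum>(x,l)\<in>\<D>. measure lborel l *\<^sub>R k x) - J) < d"
    by (rule has_integralD[OF k d]) blast
  obtain \<D> where D: "\<D> tagged_division_of (cbox a b)" "(\<lambda>x. \<gamma>1 x \<inter> \<gamma>2 x) fine \<D>"
    using fine_division_exists[OF gauge_Int[OF g1(1) g2(1)]] by blast
  let ?H = "\<Sum>(x,l)\<in>\<D>. measure lborel l *\<^sub>R h x" and ?K = "\<Sum>(x,l)\<in>\<D>. measure lborel l *\<^sub>R k x"
  have fine: "\<gamma>1 fine \<D>" "\<gamma>2 fine \<D>"
    using D(2) by (simp_all add: fine_Int)
  have H: "norm (?H - I) < d"
    by (rule g1(2)[OF D(1) fine(1)])
  have J: "norm (?K - J) < d"
    by (rule g2(2)[OF D(1) fine(2)])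
  have "p ?H \<le> (\<Sum>z\<in>\<D>. p (case z of (x,l) \<Rightarrow> measure lborel l *\<^sub>R h x))"
    by (rule sum_le)
  also have "\<dots> \<le> ?K"
  proof (rule sum_mono, clarify)
    fix x l assume "(x, l) \<in> \<D>"
    then have "x \<in> cbox a b" using D(1) by (meson subsetD tag_in_interval)
    then show "p (measure lborel l *\<^sub>R h x) \<le> measure lborel l *\<^sub>R k x"
      using le by (simp add: scale mult_left_mono)
  qed
  finally have HK: "p ?H \<le> ?K" .
  have "p I \<le> p (I - ?H) + p ?H" using triangle[of "I - ?H" ?H] by simp
  moreover have "p (I - ?H) \<le> K * d"
  proof (rule order_trans[OF K(2)])
    show "K * norm (I - ?H) \<le> K * d"
      using H K(1) by (simp add: norm_minus_commute)
  qed
  moreover have "?K \<le> J + d" using J by (simp add: abs_less_iff)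
  moreover have "K * d + d = e"
  proof -
    have "K * d + d = (K + 1) * d" by (simp add: distrib_right)
    then show ?thesis using K(1) by (simp add: d_def)
  qed
  ultimately show "p I \<le> J + e" using HK by linarith
qed

text \<open>A mean value inequality in the norm \<open>p\<close>: both increments are integrals of
  their derivatives, which \<open>has_integral_le\<close> compares.\<close>

lemma increment_le:
  fixes F :: "real \<Rightarrow> 'a"
  assumes "a \<le> b"
    and "\<And>s. s \<in> {a..b} \<Longrightarrow> (F has_vector_derivative F' s) (at s within {a..b})"
    and "\<And>s. s \<in> {a..b} \<Longrightarrow> (\<psi> has_vector_derivative \<psi>' s) (at s within {a..b})"
    and "\<And>s. s \<in> {a..b} \<Longrightarrow> p (F' s) \<le> \<psi>' s"
  shows "p (F b - F a) \<le> \<psi> b - \<psi> a"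
proof (rule has_integral_le)
  show "(F' has_integral F b - F a) (cbox a b)"
    using fundamental_theorem_of_calculus[of a b F F'] assms by simp
  show "(\<psi>' has_integral \<psi> b - \<psi> a) (cbox a b)"
    using fundamental_theorem_of_calculus[of a b \<psi> \<psi>'] assms by simp
qed (use assms in simp)

end

section \<open>Complex vector norms, their restriction to real vectors, and induced matrix
  norms\<close>

lemma scaleR_eq_vector_scalar_mult: "r *\<^sub>R (x :: complex ^ 'n) = complex_of_real r *s x"
  by (simp add: vec_eq_iff scaleR_conv_of_real[where 'a=complex])

lemma real_norm_of_vector_norm: "is_vector_norm nrm \<Longrightarrow> real_norm nrm"
  by unfold_locales (simp_all add: is_vector_norm_def scaleR_eq_vector_scalar_mult)

lemma real_norm_vec_of_real:
  assumes "is_vector_norm nrm"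
  shows "real_norm (\<lambda>x. nrm (vec_of_real x))"
proof -
  interpret real_norm nrm using assms by (rule real_norm_of_vector_norm)
  show ?thesis
  proof
    fix x y :: "real ^ 'a" and r :: real
    have "vec_of_real (x + y) = vec_of_real x + vec_of_real y"
      by (simp add: vec_of_real_def vec_eq_iff)
    then show "nrm (vec_of_real (x + y)) \<le> nrm (vec_of_real x) + nrm (vec_of_real y)"
      using triangle by simp
    have "vec_of_real (r *\<^sub>R x) = r *\<^sub>R vec_of_real x"
      by (simp add: vec_of_real_def vec_eq_iff scaleR_conv_of_real[where 'a=complex])
    then show "nrm (vec_of_real (r *\<^sub>R x)) = \<bar>r\<bar> * nrm (vec_of_real x)"
      by (simp add: scale)
    assume "nrm (vec_of_real x) = 0"
    then show "x = 0"
      using definite[of "vec_of_real x"] by (simp add: vec_of_real_def vec_eq_iff)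
  qed
qed

text \<open>A real supremum is an upper bound only of a set bounded above. Here the quotients are
  bounded because \<open>nrm\<close> is equivalent to the Euclidean norm, in which the matrix acts
  as a bounded operator.\<close>

lemma induced_matrix_norm_bound:
  fixes A :: "complex ^ 'n ^ 'n"
  assumes "is_vector_norm nrm"
  shows "nrm (A *v x) \<le> induced_matrix_norm nrm A * nrm x"
proof (cases "x = 0")
  case True
  interpret real_norm nrm using assms by (rule real_norm_of_vector_norm)
  show ?thesis using True by simp
next
  case False
  interpret real_norm nrm using assms by (rule real_norm_of_vector_norm)
  obtain K where K: "K > 0" "\<And>x. nrm x \<le> K * norm x" by (rule le_norm) blast
  obtain K' where K': "K' > 0" "\<And>x. norm x \<le> K' * nrm x" by (rule norm_le) blast
  have pos: "nrm z > 0" if "z \<noteq> 0" for z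
    using that definite[of z] nonneg[of z] by fastforce
  have "bounded_linear ((*v) A)"
    by (rule matrix_vector_mul_bounded_linear)
  then obtain B where B: "B > 0" "\<And>z. norm (A *v z) \<le> norm z * B"
    using bounded_linear.pos_bounded by blast
  have "nrm (A *v z) / nrm z \<le> K * (K' * B)" if "z \<noteq> 0" for z
  proof -
    have "nrm (A *v z) \<le> K * norm (A *v z)" by (rule K(2))
    also have "\<dots> \<le> K * (norm z * B)" using B K by simp
    also have "\<dots> \<le> K * ((K' * nrm z) * B)" using B K K' by simp
    finally show ?thesis using pos[OF that] by (simp add: field_simps)
  qed
  then have "bdd_above ((\<lambda>z. nrm (A *v z) / nrm z) ` {z. z \<noteq> 0})"
    by (intro bdd_aboveI2) auto
  then have "nrm (A *v x) / nrm x \<le> induced_matrix_norm nrm A"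
    unfolding induced_matrix_norm_def using False by (intro cSUP_upper) auto
  then show ?thesis using pos[OF False] by (simp add: field_simps)
qed

lemma mat_of_real_mult_vec_of_real: "mat_of_real M *v vec_of_real x = vec_of_real (M *v x)"
  by (simp add: vec_eq_iff mat_of_real_def vec_of_real_def matrix_vector_mult_def map_matrix_def)

section \<open>The matrix exponential\<close>

abbreviation matrix_power :: "real ^ 'n ^ 'n \<Rightarrow> nat \<Rightarrow> real ^ 'n ^ 'n" where
  "matrix_power B k \<equiv> ((**) B ^^ k) (mat 1)"

text \<open>The powers are built by multiplying from the left; differentiating the exponential
  series calls for the factor \<open>B\<close> on the right.\<close>

lemma matrix_power_Suc_right: "matrix_power B (Suc k) = matrix_power B k ** B"
  by (induction k) (simp_all add: matrix_mul_assoc)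

lemma matrix_power_scaleR: "matrix_power (t *\<^sub>R B) k = t ^ k *\<^sub>R matrix_power B k"
  by (induction k)
    (simp_all add: vec_eq_iff matrix_matrix_mult_def sum_distrib_left mult_ac)

text \<open>The sum of the absolute values of all entries dominates every row sum, so each further
  factor \<open>B\<close> enlarges the entries by at most this constant.\<close>

lemma matrix_power_entry_le:
  "\<bar>matrix_power B k $ i $ j\<bar> \<le> (\<Sum>i\<in>UNIV. \<Sum>j\<in>UNIV. \<bar>B $ i $ j\<bar>) ^ k"
proof (induction k arbitrary: i)
  case 0
  then show ?case by (simp add: mat_def)
next
  case (Suc k)
  let ?K = "\<Sum>i\<in>UNIV. \<Sum>j\<in>UNIV. \<bar>B $ i $ j\<bar>"
  have K: "0 \<le> ?K" by (simp add: sum_nonneg)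
  have "\<bar>matrix_power B (Suc k) $ i $ j\<bar> \<le> (\<Sum>l\<in>UNIV. \<bar>B $ i $ l * matrix_power B k $ l $ j\<bar>)"
    by (simp add: matrix_matrix_mult_def sum_abs)
  also have "\<dots> \<le> (\<Sum>l\<in>UNIV. \<bar>B $ i $ l\<bar> * ?K ^ k)"
    unfolding abs_mult by (intro sum_mono mult_left_mono Suc.IH) simp
  also have "\<dots> = (\<Sum>l\<in>UNIV. \<bar>B $ i $ l\<bar>) * ?K ^ k"
    by (simp add: sum_distrib_right)
  also have "\<dots> \<le> ?K * ?K ^ k"
    using K by (intro mult_right_mono member_le_sum) (auto simp: sum_nonneg)
  finally show ?case by simp
qed

lemma summable_matrix_exp_entry:
  "summable (\<lambda>k. matrix_power B k $ i $ j / fact k * t ^ k)"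
proof (rule summable_comparison_test')
  let ?K = "\<Sum>i\<in>UNIV. \<Sum>j\<in>UNIV. \<bar>B $ i $ j\<bar>"
  show "summable (\<lambda>k. inverse (fact k) * (?K * \<bar>t\<bar>) ^ k)"
    by (rule summable_exp)
  show "norm (matrix_power B k $ i $ j / fact k * t ^ k) \<le> inverse (fact k) * (?K * \<bar>t\<bar>) ^ k" for k
    using mult_right_mono[OF matrix_power_entry_le[where B = B and k = k and i = i and j = j], of "\<bar>t\<bar> ^ k"]
    by (simp add: abs_mult power_abs power_mult_distrib field_simps)
qed

text \<open>Convergence of matrices is convergence of the entries, so each entry of the exponential
  is a scalar power series in \<open>t\<close>. This makes termwise differentiation
  available.\<close>

lemma matrix_exp_entry:
  "matrix_exp (t *\<^sub>R B) $ i $ j = (\<Sum>k. matrix_power B k $ i $ j / fact k * t ^ k)"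
proof -
  let ?S = "\<chi> i j. \<Sum>k. matrix_power B k $ i $ j / fact k * t ^ k"
  have "(\<lambda>k. (1 / fact k) *\<^sub>R matrix_power (t *\<^sub>R B) k) sums ?S"
    unfolding sums_def
  proof (intro vec_tendstoI)
    fix i j
    show "(\<lambda>n. (\<Sum>k<n. (1 / fact k) *\<^sub>R matrix_power (t *\<^sub>R B) k) $ i $ j) \<longlonglongrightarrow> ?S $ i $ j"
      using summable_LIMSEQ[OF summable_matrix_exp_entry[of B i j t]]
      by (simp add: matrix_power_scaleR mult_ac)
  qed
  then have "matrix_exp (t *\<^sub>R B) = ?S"
    unfolding matrix_exp_def by (rule sums_unique[symmetric])
  then show ?thesis by simp
qed

lemma matrix_exp_zero: "matrix_exp (0 :: real ^ 'n ^ 'n) = mat 1"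
proof -
  have "matrix_exp (0 *\<^sub>R 0) $ i $ j = mat 1 $ i $ j" for i j :: 'n
    unfolding matrix_exp_entry by (simp only: powser_zero) simp
  then show ?thesis by (simp add: vec_eq_iff)
qed

text \<open>Each entry is differentiated termwise as a power series. With \<open>B\<close> on the
  right, the derivative later cancels against the linear term of the differential equation by
  associativity alone.\<close>

lemma matrix_exp_has_vector_derivative:
  fixes B :: "real ^ 'n ^ 'n"
  shows "((\<lambda>t. matrix_exp (t *\<^sub>R B)) has_vector_derivative matrix_exp (t *\<^sub>R B) ** B) (at t within S)"
proof -
  have entry: "((\<lambda>t. matrix_exp (t *\<^sub>R B) $ i $ j) has_real_derivative
      (matrix_exp (t *\<^sub>R B) ** B) $ i $ j) (at t)" for i j
  proof -
    let ?c = "\<lambda>k. matrix_power B k $ i $ j / fact k"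
    have "diffs ?c k * t ^ k = (\<Sum>l\<in>UNIV. matrix_power B k $ i $ l / fact k * t ^ k * B $ l $ j)"
      for k
    proof -
      have "diffs ?c k = matrix_power B (Suc k) $ i $ j / fact k"
        by (simp add: diffs_def del: funpow.simps of_nat_Suc)
      then show ?thesis
        unfolding matrix_power_Suc_right
        by (simp add: matrix_matrix_mult_def sum_divide_distrib sum_distrib_left mult_ac)
    qed
    then have "(\<lambda>k. diffs ?c k * t ^ k) sums (\<Sum>l\<in>UNIV. matrix_exp (t *\<^sub>R B) $ i $ l * B $ l $ j)"
      unfolding matrix_exp_entry
      by (simp only:) (intro sums_sum sums_mult2 summable_sums summable_matrix_exp_entry)
    then have "(\<Sum>k. diffs ?c k * t ^ k) = (matrix_exp (t *\<^sub>R B) ** B) $ i $ j"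
      by (simp add: sums_iff matrix_matrix_mult_def)
    then show ?thesis
      using termdiffs_strong_converges_everywhere[of ?c t] summable_matrix_exp_entry[of B i j]
      unfolding matrix_exp_entry by simp
  qed
  show ?thesis
    unfolding has_vector_derivative_def
  proof (subst has_derivative_componentwise_within, intro ballI)
    fix b :: "real ^ 'n ^ 'n" assume "b \<in> Basis"
    then obtain i j where b: "b = axis i (axis j 1)"
      by (auto simp: Basis_vec_def)
    show "((\<lambda>t. matrix_exp (t *\<^sub>R B) \<bullet> b) has_derivative
        (\<lambda>h. (h *\<^sub>R (matrix_exp (t *\<^sub>R B) ** B)) \<bullet> b)) (at t within S)"
      using has_field_derivative_at_within[OF entry[of i j], of S]
      by (simp add: b inner_axis has_field_derivative_def mult_commute_abs)
  qed
qed

lemma matrix_vector_mult_has_vector_derivative: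
  fixes M :: "real \<Rightarrow> real ^ 'n ^ 'm"
  assumes "(M has_vector_derivative M') (at s within S)"
    and "(x has_vector_derivative x') (at s within S)"
  shows "((\<lambda>s. M s *v x s) has_vector_derivative M s *v x' + M' *v x s) (at s within S)"
proof -
  have "bounded_bilinear ((*v) :: real ^ 'n ^ 'm \<Rightarrow> real ^ 'n \<Rightarrow> real ^ 'm)"
    unfolding bilinear_conv_bounded_bilinear[symmetric] bilinear_def
    by (auto intro!: linearI simp: matrix_vector_right_distrib matrix_vector_mult_add_rdistrib
        scaleR_matrix_vector_assoc[symmetric] matrix_vector_mult_scaleR)
  from bounded_bilinear.has_vector_derivative[OF this assms] show ?thesis .
qed

section \<open>The error of the waveform relaxation\<close>

lemma phi_1: "phi 1 z = (if z = 0 then 1 else (exp z - 1) / z)"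
  by simp

text \<open>For nonzero \<open>\<omega>\<close> the expression equals
  \<open>(1 - exp (- \<omega> * s)) / \<omega>\<close>, and for \<open>\<omega> = 0\<close> it is
  \<open>s\<close>; both are nondecreasing in \<open>s\<close>.\<close>

lemma phi_1_mono:
  fixes \<omega> s t :: real
  assumes "0 \<le> \<omega>" "0 \<le> s" "s \<le> t"
  shows "s * phi 1 (- \<omega> * s) \<le> t * phi 1 (- \<omega> * t)"
proof (cases "\<omega> = 0")
  case False
  have *: "u * phi 1 (- \<omega> * u) = (1 - exp (- \<omega> * u)) / \<omega>" for u
    using False by (simp add: phi_1 field_simps)
  show ?thesis unfolding * using assms by (intro divide_right_mono) (auto simp: mult_left_mono)
qed (use assms in \<open>simp add: phi_1\<close>)

text \<open>Variation of constants for a zero initial value: the homogeneous part is absorbed by the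
  exponential, and only the inhomogeneity \<open>r\<close> drives the growth of
  \<open>e\<close>.\<close>

lemma linear_ode_bound:
  fixes nrm :: "complex ^ 'n \<Rightarrow> real" and e :: "real \<Rightarrow> real ^ 'n"
  assumes nrm: "is_vector_norm nrm" and "0 \<le> t" "0 \<le> C"
    and ode: "\<And>s. s \<in> {0..t} \<Longrightarrow> (e has_vector_derivative - (A *v e s) + r s) (at s within {0..t})"
    and init: "e 0 = 0"
    and exp_bound: "\<And>s. s \<ge> 0 \<Longrightarrow>
          induced_matrix_norm nrm (mat_of_real (matrix_exp (- (s *\<^sub>R A)))) \<le> C * exp (- \<omega> * s)"
    and r: "\<And>s. s \<in> {0..t} \<Longrightarrow> nrm (vec_of_real (r s)) \<le> R"
  shows "nrm (vec_of_real (e t)) \<le> C * R * (t * phi 1 (- \<omega> * t))"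
proof -
  interpret real_norm "\<lambda>x :: real ^ 'n. nrm (vec_of_real x)"
    using nrm by (rule real_norm_vec_of_real)
  let ?E = "\<lambda>s. matrix_exp ((t - s) *\<^sub>R - A)"
  \<comment> \<open>A primitive of \<open>C * exp (- \<omega> * (t - s)) * R\<close> in
    \<open>s\<close>; the case \<open>\<omega> = 0\<close> is separate because the quotient would
    divide by zero.\<close>
  define \<psi> where "\<psi> s = C * R * (if \<omega> = 0 then s else exp (- \<omega> * (t - s)) / \<omega>)" for s
  have "nrm (vec_of_real (?E t *v e t - ?E 0 *v e 0)) \<le> \<psi> t - \<psi> 0"
  proof (rule increment_le[where F = "\<lambda>s. ?E s *v e s" and F' = "\<lambda>s. ?E s *v r s"
        and \<psi>' = "\<lambda>s. C * exp (- \<omega> * (t - s)) * R"])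
    fix s assume s: "s \<in> {0..t}"
    have "((\<lambda>s. t - s) has_vector_derivative - 1) (at s within {0..t})"
      by (auto intro!: derivative_eq_intros)
    from vector_diff_chain_within[OF this matrix_exp_has_vector_derivative[of "- A"]]
    have "(?E has_vector_derivative - (?E s ** - A)) (at s within {0..t})"
      by (simp add: o_def)
    then have "((\<lambda>s. ?E s *v e s) has_vector_derivative
        ?E s *v (- (A *v e s) + r s) + (- (?E s ** - A)) *v e s) (at s within {0..t})"
      by (rule matrix_vector_mult_has_vector_derivative[OF _ ode[OF s]])
    moreover have "?E s *v (- (A *v e s) + r s) + (- (?E s ** - A)) *v e s = ?E s *v r s"
    proof -
      \<comment> \<open>The derivative of the exponential contributes \<open>?E s ** A\<close>,
        which cancels the term \<open>- (A *v e s)\<close> of the equation.\<close>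
      have "- (?E s ** - A) = ?E s ** A"
        by (simp add: vec_eq_iff matrix_matrix_mult_def sum_negf)
      then show ?thesis
        using matrix_vector_mult_diff_distrib[of "?E s" "r s" "A *v e s"]
        by (simp add: matrix_vector_mul_assoc)
    qed
    ultimately show "((\<lambda>s. ?E s *v e s) has_vector_derivative ?E s *v r s) (at s within {0..t})"
      by simp
    show "(\<psi> has_vector_derivative C * exp (- \<omega> * (t - s)) * R) (at s within {0..t})"
      unfolding \<psi>_def has_real_derivative_iff_has_vector_derivative[symmetric]
      by (cases "\<omega> = 0") (auto intro!: derivative_eq_intros)
    have "nrm (vec_of_real (?E s *v r s))
        \<le> induced_matrix_norm nrm (mat_of_real (?E s)) * nrm (vec_of_real (r s))"
      using induced_matrix_norm_bound[OF nrm] by (simp flip: mat_of_real_mult_vec_of_real)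
    also have "\<dots> \<le> C * exp (- \<omega> * (t - s)) * nrm (vec_of_real (r s))"
      using exp_bound[of "t - s"] s by (intro mult_right_mono nonneg) simp
    also have "\<dots> \<le> C * exp (- \<omega> * (t - s)) * R"
      using r[OF s] \<open>0 \<le> C\<close> by (intro mult_left_mono) auto
    finally show "nrm (vec_of_real (?E s *v r s)) \<le> C * exp (- \<omega> * (t - s)) * R" .
  qed (fact \<open>0 \<le> t\<close>)
  moreover have "\<psi> t - \<psi> 0 = C * R * (t * phi 1 (- \<omega> * t))"
    by (simp add: \<psi>_def phi_1 field_simps)
  ultimately show ?thesis
    by (simp add: init matrix_exp_zero)
qed

section \<open>One-step error estimate and geometric convergence of the iteration\<close>

theorem proposition1:
  fixes nrm :: "complex ^ 'n \<Rightarrow> real"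
    and \<Phi> :: "real \<Rightarrow> real ^ 'n \<Rightarrow> real ^ 'n"
    and v :: "real ^ 'n"
    and A :: "nat \<Rightarrow> real ^ 'n ^ 'n"
    and f :: "nat \<Rightarrow> real ^ 'n \<Rightarrow> real ^ 'n"
    and g :: "real \<Rightarrow> real ^ 'n"
    and y :: "real \<Rightarrow> real ^ 'n"
    and Y :: "nat \<Rightarrow> real \<Rightarrow> real ^ 'n"
    and T L C \<omega> :: real
  assumes nrm: "is_vector_norm nrm"
    and T: "T > 0"
    and y_ode: "\<And>t. t \<in> {0..T} \<Longrightarrow> (y has_vector_derivative \<Phi> t (y t)) (at t within {0..T})"
    and y_init: "y 0 = v"
    and splitting: "\<And>k t u. t \<ge> 0 \<Longrightarrow> \<Phi> t u = - (A k *v u) + f k u + g t"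
    and lipschitz: "\<And>k u w. nrm (vec_of_real (f k u - f k w)) \<le> L * nrm (vec_of_real (u - w))"
    and C: "C > 0"
    and \<omega>: "\<omega> \<ge> 0"
    and exp_bound: "\<And>k t. t \<ge> 0 \<Longrightarrow>
          induced_matrix_norm nrm (mat_of_real (matrix_exp (- (t *\<^sub>R A k)))) \<le> C * exp (- \<omega> * t)"
    and Y0_cont: "continuous_on {0..T} (Y 0)"
    and Y0_init: "Y 0 0 = v"
    and Y_ode: "\<And>k t. t \<in> {0..T} \<Longrightarrow>
          (Y (Suc k) has_vector_derivative - (A k *v Y (Suc k) t) + f k (Y k t) + g t)
            (at t within {0..T})"
    and Y_init: "\<And>k. Y (Suc k) 0 = v"
  shows "(\<forall>k. \<forall>t\<in>{0..T}.
            nrm (vec_of_real (y t - Y (Suc k) t))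
              \<le> C * L * t * phi 1 (- \<omega> * t) * (SUP s\<in>{0..t}. nrm (vec_of_real (y s - Y k s))))
         \<and> (C * L * T * phi 1 (- \<omega> * T) < 1 \<longrightarrow> uniform_limit {0..T} Y y sequentially)"
proof -
  interpret real_norm "\<lambda>x :: real ^ 'n. nrm (vec_of_real x)"
    using nrm by (rule real_norm_vec_of_real)
  define \<epsilon> where "\<epsilon> k t = nrm (vec_of_real (y t - Y k t))" for k t
  let ?h = "\<lambda>t. t * phi 1 (- \<omega> * t)"
  \<comment> \<open>The Lipschitz estimate between a unit coordinate vector and 0 forces the sign of
    \<open>L\<close>; any index and any coordinate would do.\<close>
  have L: "0 \<le> L"
  proof -
    let ?u = "axis undefined 1 :: real ^ 'n"
    have "nrm (vec_of_real ?u) \<noteq> 0" using definite[of ?u] by auto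
    then have "0 < nrm (vec_of_real ?u)" using nonneg[of ?u] by linarith
    moreover have "0 \<le> L * nrm (vec_of_real ?u)"
      using lipschitz[of undefined ?u 0] nonneg[of "f undefined ?u - f undefined 0"] by simp
    ultimately show ?thesis by (simp add: zero_le_mult_iff)
  qed
  have Y_cont: "continuous_on {0..T} (Y k)" for k
    using Y0_cont
    by (cases k) (auto intro!: continuous_on_vector_derivative Y_ode)
  have y_cont: "continuous_on {0..T} y"
    by (rule continuous_on_vector_derivative) (rule y_ode)
  have \<epsilon>_cont: "continuous_on {0..T} (\<epsilon> k)" for k
    unfolding \<epsilon>_def
    by (rule continuous_on_compose2[OF continuous_on continuous_on_diff[OF y_cont Y_cont]]) auto
  \<comment> \<open>Continuity on a compact interval makes the error bounded, so that the suprema in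
    the estimate are genuine upper bounds.\<close>
  have \<epsilon>_bdd: "bdd_above (\<epsilon> k ` {0..t})" if "t \<in> {0..T}" for k t
  proof -
    have "continuous_on {0..t} (\<epsilon> k)"
      using that by (intro continuous_on_subset[OF \<epsilon>_cont]) auto
    then show ?thesis
      by (intro bounded_imp_bdd_above compact_imp_bounded compact_continuous_image) auto
  qed
  have step: "\<epsilon> (Suc k) t \<le> C * (L * (SUP s\<in>{0..t}. \<epsilon> k s)) * ?h t" if t: "t \<in> {0..T}" for k t
    unfolding \<epsilon>_def[of "Suc k"]
  proof (rule linear_ode_bound[OF nrm, where A = "A k" and r = "\<lambda>s. f k (y s) - f k (Y k s)"])
    fix s assume s: "s \<in> {0..t}"
    then have sT: "s \<in> {0..T}" using t by auto
    have "((\<lambda>s. y s - Y (Suc k) s) has_vector_derivative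
        \<Phi> s (y s) - (- (A k *v Y (Suc k) s) + f k (Y k s) + g s)) (at s within {0..t})"
      using t
      by (intro has_vector_derivative_within_subset[OF has_vector_derivative_diff[OF y_ode[OF sT] Y_ode[OF sT]]])
        auto
    \<comment> \<open>The splitting with the index \<open>k\<close> of the current step is applied
      to the exact solution, so \<open>g\<close> cancels and only the difference of the
      \<open>f k\<close> values remains.\<close>
    moreover have "\<Phi> s (y s) - (- (A k *v Y (Suc k) s) + f k (Y k s) + g s)
        = - (A k *v (y s - Y (Suc k) s)) + (f k (y s) - f k (Y k s))"
      using splitting[of s "y s" k] s by (simp add: matrix_vector_mult_diff_distrib)
    ultimately show "((\<lambda>s. y s - Y (Suc k) s) has_vector_derivative
        - (A k *v (y s - Y (Suc k) s)) + (f k (y s) - f k (Y k s))) (at s within {0..t})"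
      by (simp only:)
    have "nrm (vec_of_real (f k (y s) - f k (Y k s))) \<le> L * \<epsilon> k s"
      unfolding \<epsilon>_def by (rule lipschitz)
    also have "\<dots> \<le> L * (SUP s\<in>{0..t}. \<epsilon> k s)"
      using s by (intro mult_left_mono cSUP_upper \<epsilon>_bdd t L)
    finally show "nrm (vec_of_real (f k (y s) - f k (Y k s))) \<le> L * (SUP s\<in>{0..t}. \<epsilon> k s)" .
  qed (use t C exp_bound in \<open>simp_all add: y_init Y_init\<close>)
  have "uniform_limit {0..T} Y y sequentially" if q1: "C * L * T * phi 1 (- \<omega> * T) < 1"
  proof -
    define q where "q = C * L * ?h T"
    define M where "M = (SUP s\<in>{0..T}. \<epsilon> 0 s)"
    have h: "0 \<le> ?h t" if "0 \<le> t" for t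
      using phi_1_mono[OF \<omega> order_refl that] by simp
    have q: "0 \<le> q" "q < 1"
      using q1 C L h[of T] T unfolding q_def by (simp_all only: mult_ac) auto
    \<comment> \<open>The time \<open>t\<close> is generalized in the induction because the supremum
      over \<open>{0..t}\<close> needs the previous bound at every earlier time.\<close>
    have bound: "\<epsilon> k t \<le> q ^ k * M" if "t \<in> {0..T}" for k t
      using that
    proof (induction k arbitrary: t)
      case 0
      then show ?case
        unfolding M_def using T by (auto intro!: cSUP_upper \<epsilon>_bdd)
    next
      case (Suc k)
      have M: "(SUP s\<in>{0..t}. \<epsilon> k s) \<le> q ^ k * M"
        using Suc by (intro cSUP_least Suc.IH) auto
      \<comment> \<open>The bound at time 0 shows that \<open>q ^ k * M\<close> is nonnegative, as
        is needed when \<open>?h t\<close> is enlarged to \<open>?h T\<close>.\<close>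
      have "0 \<le> \<epsilon> k 0" unfolding \<epsilon>_def by (rule nonneg)
      also have "\<dots> \<le> q ^ k * M" using T by (intro Suc.IH) auto
      finally have "0 \<le> q ^ k * M" .
      have "\<epsilon> (Suc k) t \<le> C * (L * (SUP s\<in>{0..t}. \<epsilon> k s)) * ?h t"
        using Suc.prems by (rule step)
      also have "\<dots> \<le> C * (L * (q ^ k * M)) * ?h t"
        using M C L h Suc.prems by (intro mult_right_mono mult_left_mono) auto
      also have "\<dots> \<le> C * (L * (q ^ k * M)) * ?h T"
        using \<open>0 \<le> q ^ k * M\<close> C L \<omega> Suc.prems by (intro mult_left_mono phi_1_mono) auto
      also have "\<dots> = q ^ Suc k * M" by (simp only: q_def power_Suc mult_ac)
      finally show ?case .
    qed
    \<comment> \<open>Uniform convergence is stated in the Euclidean distance, so the geometric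
      bound in \<open>nrm\<close> is transferred by norm equivalence.\<close>
    obtain K where K: "K > 0" "\<And>x :: real ^ 'n. norm x \<le> K * nrm (vec_of_real x)"
      by (rule norm_le) blast
    have "(\<lambda>k. K * (q ^ k * M)) \<longlonglongrightarrow> K * (0 * M)"
      using q by (intro tendsto_intros) auto
    then have lim: "(\<lambda>k. K * (q ^ k * M)) \<longlonglongrightarrow> 0" by simp
    show ?thesis
    proof (rule uniform_limitI)
      fix e :: real assume "e > 0"
      with lim have "\<forall>\<^sub>F k in sequentially. K * (q ^ k * M) < e"
        by (rule order_tendstoD)
      then show "\<forall>\<^sub>F k in sequentially. \<forall>t\<in>{0..T}. dist (Y k t) (y t) < e"
      proof eventually_elim
        case (elim k)
        show ?case
        proof
          fix t assume t: "t \<in> {0..T}"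
          have "dist (Y k t) (y t) \<le> K * \<epsilon> k t"
            using K(2)[of "y t - Y k t"] by (simp add: \<epsilon>_def dist_norm norm_minus_commute)
          also have "\<dots> \<le> K * (q ^ k * M)"
            using bound[OF t] K(1) by simp
          finally show "dist (Y k t) (y t) < e" using elim by simp
        qed
      qed
    qed
  qed
  then show ?thesis
    using step unfolding \<epsilon>_def by (simp only: mult_ac) auto
qed

end
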